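(* Assume $\mathrm{cof}(\mathcal M)=\omega_1$. Then a Gross space of dimension $\aleph_1$ exists over every finite field.
   Context: $\mathcal M$ denotes the family of meagre subsets of $2^\omega$ (the product of countably many copies of the discrete space $\{0,1\}$), and $\mathrm{cof}(\mathcal M)$ is the minimal cardinality of a family $\mathcal F\subseteq\mathcal M$ such that every $A\in\mathcal M$ is contained in some $B\in\mathcal F$. A Gross space is an infinite-dimensional vector space $E$ with a symmetric bilinear form $\Phi$ such that every infinite-dimensional subspace $U$ satisfies $\dim U^\perp<\dim E$, where $U^\perp=\{x:\Phi(x,y)=0\ \forall y\in U\}$. *)

theory Defs
  imports "HOL-Analysis.Analysis" "HOL-Library.Poly_Mapping"
begin

unbundle cardinal_syntax
no_notation elt_set_eq (infix \<open>=o\<close> 50)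

section \<open>Meagre sets and cofinality\<close>

definition nowhere_dense :: "'a::topological_space set \<Rightarrow> bool" where
  "nowhere_dense N \<longleftrightarrow> interior (closure N) = {}"

text \<open>The Cantor space \<open>2\<^sup>\<omega>\<close> is the type \<open>nat \<Rightarrow> bool\<close>: functions carry the product topology and
  \<open>bool\<close> is an instance of \<open>discrete_topology\<close>.\<close>

definition meagre :: "'a::topological_space set \<Rightarrow> bool" where
  "meagre A \<longleftrightarrow> (\<exists>N :: nat \<Rightarrow> 'a set. (\<forall>n. nowhere_dense (N n)) \<and> A = (\<Union>n. N n))"

definition cofinal_in :: "'a set set \<Rightarrow> 'a set set \<Rightarrow> bool" where
  "cofinal_in \<I> F \<longleftrightarrow> F \<subseteq> \<I> \<and> (\<forall>A\<in>\<I>. \<exists>B\<in>F. A \<subseteq> B)"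

text \<open>Cardinals are represented, as in the library, by cardinal orders up to \<open>=o\<close>. The two lemmas
  after the definition show that the choice is always possible, so that the value is the least
  cardinality of a cofinal subfamily.\<close>

definition cof :: "'a set set \<Rightarrow> 'a set rel" where
  "cof \<I> = |SOME F. cofinal_in \<I> F \<and> (\<forall>G. cofinal_in \<I> G \<longrightarrow> |F| \<le>o |G| )|"

lemma cof_attained: "\<exists>F. cofinal_in \<I> F \<and> cof \<I> = |F|"
  and cof_least: "cofinal_in \<I> G \<Longrightarrow> cof \<I> \<le>o |G|"
proof -
  let ?R = "card_of ` {F. cofinal_in \<I> F}"
  have "cofinal_in \<I> \<I>"
    by (auto simp: cofinal_in_def)
  then have "?R \<noteq> {}"
    by blast
  moreover have "\<forall>r\<in>?R. Card_order r"
    by (auto intro: card_of_Card_order)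
  ultimately obtain r where "r \<in> ?R" "\<forall>r'\<in>?R. r \<le>o r'"
    using exists_minim_Card_order[of ?R] by auto
  then have "\<exists>F. cofinal_in \<I> F \<and> (\<forall>G. cofinal_in \<I> G \<longrightarrow> |F| \<le>o |G| )"
    by auto
  then have *: "cofinal_in \<I> F \<and> (\<forall>G. cofinal_in \<I> G \<longrightarrow> |F| \<le>o |G| )"
    if "F = (SOME F. cofinal_in \<I> F \<and> (\<forall>G. cofinal_in \<I> G \<longrightarrow> |F| \<le>o |G| ))" for F
    unfolding that by (rule someI_ex)
  show "\<exists>F. cofinal_in \<I> F \<and> cof \<I> = |F|"
    using *[OF refl] by (auto simp: cof_def)
  show "cof \<I> \<le>o |G|" if "cofinal_in \<I> G"
    using *[OF refl] that by (auto simp: cof_def)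
qed

section \<open>Dimension as a cardinal, and Gross spaces\<close>

lemma card_finite_le:
  assumes "finite A" "infinite B"
  shows "|A| \<le>o |B|"
proof -
  obtain B' where "B' \<subseteq> B" "finite B'" "card B' = card A"
    using infinite_arbitrarily_large[OF assms(2), of "card A"] by blast
  then obtain f where "bij_betw f A B'"
    using finite_same_card_bij[OF assms(1)] by metis
  then show ?thesis
    using \<open>B' \<subseteq> B\<close> by (metis bij_betw_def card_of_ordLeq)
qed

lemma card_finite_subsets_le:
  assumes "infinite C"
  shows "|{F. F \<subseteq> C \<and> finite F}| \<le>o |C|"
proof -
  define W where "W n = {F. F \<subseteq> C \<and> finite F \<and> card F = n}" for n
  have W: "|W n| \<le>o |C|" for n
  proof (induction n)
    case 0
    have "W 0 = {{}}"
      by (auto simp: W_def)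
    then show ?case
      using assms by (simp add: card_finite_le)
  next
    case (Suc n)
    have "W (Suc n) \<subseteq> (\<Union>a\<in>C. insert a ` W n)"
    proof
      fix F assume F: "F \<in> W (Suc n)"
      then obtain a F' where "F = insert a F'" "a \<notin> F'" "card F' = n" "finite F'"
        by (auto simp: W_def card_Suc_eq_finite)
      then show "F \<in> (\<Union>a\<in>C. insert a ` W n)"
        using F by (auto simp: W_def)
    qed
    moreover have "|\<Union>a\<in>C. insert a ` W n| \<le>o |C|"
    proof (rule card_of_UNION_ordLeq_infinite[OF assms])
      show "|C| \<le>o |C|"
        by (rule ordIso_imp_ordLeq[OF card_of_refl])
      show "\<forall>a\<in>C. |insert a ` W n| \<le>o |C|"
        using ordLeq_transitive[OF card_of_image Suc] by blast
    qed
    ultimately show ?case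
      by (rule ordLeq_transitive[OF card_of_mono1])
  qed
  have "{F. F \<subseteq> C \<and> finite F} = (\<Union>n. W n)"
    by (auto simp: W_def)
  then show ?thesis
    using card_of_UNION_ordLeq_infinite[OF assms infinite_iff_card_of_nat[THEN iffD1, OF assms], of W] W
    by simp
qed

definition basis_of :: "('k::field \<Rightarrow> 'v::ab_group_add \<Rightarrow> 'v) \<Rightarrow> 'v set \<Rightarrow> 'v set \<Rightarrow> bool" where
  "basis_of s V B \<longleftrightarrow> B \<subseteq> V \<and> \<not> module.dependent s B \<and> module.span s B = V"

text \<open>The library's \<open>dim\<close> is a natural number and does not distinguish infinite dimensions. The
  lemma \<open>cdim_eq_card_basis\<close> below shows that the choice of the basis is immaterial.\<close>

definition cdim :: "('k::field \<Rightarrow> 'v::ab_group_add \<Rightarrow> 'v) \<Rightarrow> 'v set \<Rightarrow> 'v rel" where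
  "cdim s V = |SOME B. basis_of s V B|"

context vector_space
begin

lemma basis_of_exists:
  assumes "subspace V"
  shows "\<exists>B. basis_of scale V B"
proof -
  obtain B where "B \<subseteq> V" "independent B" "V \<subseteq> span B"
    using maximal_independent_subset[of V] by blast
  then show ?thesis
    using span_minimal[OF _ assms] unfolding basis_of_def by blast
qed

lemma card_independent_le:
  assumes B: "independent B" and BC: "B \<subseteq> span C"
  shows "|B| \<le>o |C|"
proof (cases "finite C")
  case True
  then have "finite B" "card B \<le> card C"
    using independent_span_bound[OF True B BC] by blast+
  then obtain f where "f ` B \<subseteq> C" "inj_on f B"
    using card_le_inj[OF _ True] by blast
  then show ?thesis
    using card_of_ordLeq by blast
next
  case False
  define \<F> where "\<F> = {F. F \<subseteq> C \<and> finite F}"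
  have fin: "finite (B \<inter> span F)" if "F \<in> \<F>" for F
  proof -
    have "finite F"
      using that by (simp add: \<F>_def)
    moreover have "independent (B \<inter> span F)"
      by (rule independent_mono[OF B]) simp
    ultimately show ?thesis
      using independent_span_bound[of F "B \<inter> span F"] by simp
  qed
  have "B \<subseteq> (\<Union>F\<in>\<F>. B \<inter> span F)"
  proof
    fix b assume b: "b \<in> B"
    then have "b \<in> span C"
      using BC by blast
    then obtain F r where F: "finite F" "F \<subseteq> C" and b_eq: "b = (\<Sum>a\<in>F. scale (r a) a)"
      unfolding span_explicit by blast
    have "(\<Sum>a\<in>F. scale (r a) a) \<in> span F"
      by (intro span_sum span_scale span_base)
    then have "b \<in> span F"
      by (simp add: b_eq)
    then show "b \<in> (\<Union>F\<in>\<F>. B \<inter> span F)"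
      using b F by (auto simp: \<F>_def)
  qed
  then have "|B| \<le>o |\<Union>F\<in>\<F>. B \<inter> span F|"
    by (rule card_of_mono1)
  moreover have "|\<Union>F\<in>\<F>. B \<inter> span F| \<le>o |C|"
  proof (rule card_of_UNION_ordLeq_infinite[OF False])
    show "|\<F>| \<le>o |C|"
      unfolding \<F>_def using False by (rule card_finite_subsets_le)
    show "\<forall>F\<in>\<F>. |B \<inter> span F| \<le>o |C|"
      using card_finite_le[OF fin False] by blast
  qed
  ultimately show ?thesis
    by (rule ordLeq_transitive)
qed

lemma cdim_eq_card_basis:
  assumes "basis_of scale V B"
  shows "cdim scale V =o |B|"
proof -
  define B' where "B' = (SOME B. basis_of scale V B)"
  have "basis_of scale V B'"
    using assms unfolding B'_def by (rule someI)
  then have "|B'| \<le>o |B|" "|B| \<le>o |B'|"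
    using assms unfolding basis_of_def by (metis card_independent_le)+
  then show ?thesis
    by (simp add: cdim_def B'_def ordIso_iff_ordLeq)
qed

end

text \<open>The Gross space is the subspace \<open>E\<close>; the type of the vectors is only an ambient space, and the
  values of \<open>\<Phi>\<close> outside \<open>E\<close> are irrelevant. For dimension \<open>\<aleph>\<^sub>1\<close> the type
  \<open>nat set \<Rightarrow>\<^sub>0 'k\<close> of finitely supported functions is a sufficient ambient space: under pointwise
  scaling its dimension is the continuum, so every vector space of dimension \<open>\<aleph>\<^sub>1\<close> over \<open>'k\<close> is
  isomorphic to one of its subspaces.\<close>

locale gross_space = vector_space scale
  for scale :: "'k::field \<Rightarrow> 'v::ab_group_add \<Rightarrow> 'v" +
  fixes E :: "'v set" and \<Phi> :: "'v \<Rightarrow> 'v \<Rightarrow> 'k"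
  assumes subspace_E: "module.subspace scale E"
    and infinite_dim_E: "cinfinite (cdim scale E)"
    and form_symmetric: "\<lbrakk>x \<in> E; y \<in> E\<rbrakk> \<Longrightarrow> \<Phi> x y = \<Phi> y x"
    and form_add_left: "\<lbrakk>x \<in> E; y \<in> E; z \<in> E\<rbrakk> \<Longrightarrow> \<Phi> (x + y) z = \<Phi> x z + \<Phi> y z"
    and form_scale_left: "\<lbrakk>x \<in> E; y \<in> E\<rbrakk> \<Longrightarrow> \<Phi> (scale c x) y = c * \<Phi> x y"
    and form_add_right: "\<lbrakk>x \<in> E; y \<in> E; z \<in> E\<rbrakk> \<Longrightarrow> \<Phi> x (y + z) = \<Phi> x y + \<Phi> x z"
    and form_scale_right: "\<lbrakk>x \<in> E; y \<in> E\<rbrakk> \<Longrightarrow> \<Phi> x (scale c y) = c * \<Phi> x y"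
    and orthogonal_small:
      "\<lbrakk>module.subspace scale U; U \<subseteq> E; cinfinite (cdim scale U)\<rbrakk>
        \<Longrightarrow> cdim scale {x \<in> E. \<forall>y\<in>U. \<Phi> x y = 0} <o cdim scale E"

end

theory Submission
  imports Defs "HOL-Library.Countable_Set_Type"
begin

text \<open>A meagre subset of \<open>2\<^sup>\<omega>\<close> is contained in a set of the form
  \<open>{x. for almost all m, x and z differ on J m}\<close>, where \<open>z \<in> 2\<^sup>\<omega>\<close> and the \<open>J m\<close> are disjoint and finite.
  If the set of this form given by \<open>(S, t)\<close> is contained in the one given by \<open>(J, z)\<close>, then almost every
  \<open>J m\<close> contains some \<open>S n\<close> on which \<open>z\<close> and \<open>t\<close> agree. Hence \<open>cof(M) = \<omega>\<^sub>1\<close> provides \<open>\<omega>\<^sub>1\<close> many codes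
  \<open>(J, z)\<close> such that every \<open>(S, t)\<close> is captured by one of them in this sense.

  The form is defined on the space with basis \<open>e \<gamma>\<close>, \<open>\<gamma> < \<omega>\<^sub>1\<close>, by recursion on \<open>\<gamma>\<close>: the values
  \<open>\<Phi>(e \<gamma>, e i)\<close>, \<open>i < \<gamma>\<close>, are chosen such that for every \<open>\<alpha> < \<gamma>\<close>, every code with index \<open>\<xi> < \<gamma>\<close> and every
  vector \<open>x\<close> with top index \<open>\<gamma>\<close>, there are infinitely many \<open>m\<close> for which \<open>\<Phi>(x, e i)\<close> agrees with \<open>z\<close> on
  \<open>J m\<close>, transported to \<open>\<alpha>\<close>; these are countably many conditions as the field is finite.
  An infinite-dimensional subspace contains nonzero vectors \<open>u n\<close> with disjoint supports \<open>S n\<close>. Let \<open>t\<close>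
  be nonzero on each \<open>u n\<close>. If \<open>(J, z)\<close> captures \<open>(S, t)\<close>, then no \<open>x\<close> with a large top index is
  orthogonal to all \<open>u n\<close>, so the orthogonal complement is countable.\<close>

section \<open>Meagre sets of the Cantor space\<close>

text \<open>The one construction principle behind codes, capturing, generic functions and disjoint
  vectors: a requirement that can be met outside any given finite set can be met again and again by
  disjoint sets.\<close>

lemma disjoint_sequence:
  fixes Q :: "nat \<Rightarrow> 'a set \<Rightarrow> bool"
  assumes "\<And>m D. finite D \<Longrightarrow> \<exists>J. finite J \<and> J \<inter> D = {} \<and> Q m J"
  shows "\<exists>J. (\<forall>m. finite (J m) \<and> Q m (J m)) \<and> (\<forall>m n. m \<noteq> n \<longrightarrow> J m \<inter> J n = {})"
proof -
  \<comment> \<open>A state is a pair: \<open>fst S\<close> contains everything chosen so far and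
    has to be avoided later, \<open>snd S\<close> is the latest set.\<close>
  define P where "P n S \<longleftrightarrow> finite (fst S) \<and> finite (snd S) \<and> snd S \<subseteq> fst S \<and> Q n (snd S)"
    for n and S :: "'a set \<times> 'a set"
  define N where "N S S' \<longleftrightarrow> fst S \<subseteq> fst S' \<and> snd S' \<inter> fst S = {}" for S S' :: "'a set \<times> 'a set"
  have "\<exists>f. \<forall>n. P n (f n) \<and> N (f n) (f (Suc n))"
  proof (rule dependent_nat_choice)
    obtain J where "finite J" "Q 0 J"
      using assms[of "{}" 0] by auto
    then have "P 0 (J, J)"
      by (simp add: P_def)
    then show "\<exists>S. P 0 S" ..
  next
    fix S n
    assume "P n S"
    then have "finite (fst S)"
      by (simp add: P_def)
    from assms[OF this, of "Suc n"]
    obtain J where "finite J" "J \<inter> fst S = {}" "Q (Suc n) J"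
      by blast
    with \<open>finite (fst S)\<close> have "P (Suc n) (fst S \<union> J, J) \<and> N S (fst S \<union> J, J)"
      by (auto simp: P_def N_def)
    then show "\<exists>S'. P (Suc n) S' \<and> N S S'" ..
  qed
  then obtain f where f: "\<And>n. P n (f n)" "\<And>n. N (f n) (f (Suc n))"
    by blast
  have "fst (f n) \<subseteq> fst (f (Suc n))" for n
    using f(2)[of n] by (simp add: N_def)
  then have mono: "fst (f m) \<subseteq> fst (f n)" if "m \<le> n" for m n
    using lift_Suc_mono_le[of "\<lambda>n. fst (f n)", OF _ that] by blast
  have disj: "snd (f m) \<inter> snd (f n) = {}" if "m < n" for m n
  proof -
    from that obtain k where k: "n = Suc k"
      by (cases n) auto
    then have "snd (f m) \<subseteq> fst (f k)"
      using f(1)[of m] mono[of m k] that by (auto simp: P_def)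
    then show ?thesis
      using f(2)[of k] by (auto simp: N_def k)
  qed
  show ?thesis
  proof (intro exI[of _ "\<lambda>n. snd (f n)"] conjI allI impI)
    show "snd (f m) \<inter> snd (f n) = {}" if "m \<noteq> n" for m n
      using disj[of m n] disj[of n m] that by (cases m n rule: linorder_cases) auto
  qed (use f(1) in \<open>auto simp: P_def\<close>)
qed

lemma disjoint_from_finite:
  fixes J :: "nat \<Rightarrow> 'a set"
  assumes "\<And>m n. m \<noteq> n \<Longrightarrow> J m \<inter> J n = {}" and "finite D"
  shows "\<forall>\<^sub>\<infinity>m. J m \<inter> D = {}"
proof -
  have "\<forall>\<^sub>\<infinity>m. d \<notin> J m" for d
  proof (cases "\<exists>k. d \<in> J k")
    case True
    then obtain k where "d \<in> J k" ..
    then have "d \<notin> J m" if "m > k" for m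
      using assms(1)[of k m] that by auto
    then show ?thesis
      unfolding MOST_nat by blast
  qed simp
  then have "\<forall>\<^sub>\<infinity>m. \<forall>d\<in>D. d \<notin> J m"
    using assms(2) by (simp add: eventually_ball_finite)
  then show ?thesis
    by (rule eventually_mono) auto
qed

section \<open>Nowhere dense sets and cylinders\<close>

lemma open_cylinder: "finite D \<Longrightarrow> open {v :: nat \<Rightarrow> bool. \<forall>i\<in>D. v i = y i}"
  using product_topology_basis'[of D "\<lambda>i. {y i}" id] by (simp add: open_discrete)

lemma open_contains_cylinder:
  fixes y :: "nat \<Rightarrow> bool"
  assumes "open U" "y \<in> U"
  obtains D where "finite D" "{v. \<forall>i\<in>D. v i = y i} \<subseteq> U"
proof -
  have "openin (product_topology (\<lambda>_. euclidean) UNIV) U"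
    using assms(1) by (simp add: open_fun_def)
  from product_topology_open_contains_basis[OF this assms(2)]
  obtain X where X: "y \<in> Pi\<^sub>E UNIV X" "finite {i. X i \<noteq> (UNIV :: bool set)}" "Pi\<^sub>E UNIV X \<subseteq> U"
    by auto
  show ?thesis
  proof
    show "finite {i. X i \<noteq> (UNIV :: bool set)}"
      by fact
    show "{v. \<forall>i\<in>{i. X i \<noteq> UNIV}. v i = y i} \<subseteq> U"
    proof
      fix v assume v: "v \<in> {v. \<forall>i\<in>{i. X i \<noteq> UNIV}. v i = y i}"
      have "v i \<in> X i" for i
        using v X(1) by (cases "X i = UNIV") auto
      then show "v \<in> U"
        using X(3) by auto
    qed
  qed
qed

text \<open>Cylinders form a base, so \<open>closure N\<close> has empty interior exactly if every
  cylinder contains a point with a cylinder around it that misses \<open>N\<close>. From here on the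
  topology is finite combinatorics.\<close>

lemma nowhere_dense_cantor_iff:
  fixes N :: "(nat \<Rightarrow> bool) set"
  shows "nowhere_dense N \<longleftrightarrow>
    (\<forall>D x. finite D \<longrightarrow>
      (\<exists>D' y. finite D' \<and> (\<forall>i\<in>D. y i = x i) \<and> (\<forall>v. (\<forall>i\<in>D'. v i = y i) \<longrightarrow> v \<notin> N)))"
    (is "_ \<longleftrightarrow> ?R")
proof
  assume N: "nowhere_dense N"
  show ?R
  proof (intro allI impI)
    fix D x assume "finite (D :: nat set)"
    let ?C = "{v :: nat \<Rightarrow> bool. \<forall>i\<in>D. v i = x i}"
    have "\<not> ?C \<subseteq> closure N"
      using N interior_maximal[OF _ open_cylinder[OF \<open>finite D\<close>, of x], of "closure N"]
      by (auto simp: nowhere_dense_def)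
    then obtain y where y: "y \<in> ?C" "y \<in> - closure N"
      by blast
    have "open (- closure N)"
      by (rule open_Compl[OF closed_closure])
    from open_contains_cylinder[OF this y(2)]
    obtain D' where D': "finite D'" "{v. \<forall>i\<in>D'. v i = y i} \<subseteq> - closure N" .
    then have "\<forall>v. (\<forall>i\<in>D'. v i = y i) \<longrightarrow> v \<notin> N"
      using closure_subset by blast
    moreover have "\<forall>i\<in>D. y i = x i"
      using y(1) by simp
    ultimately show "\<exists>D' y. finite D' \<and> (\<forall>i\<in>D. y i = x i) \<and>
        (\<forall>v. (\<forall>i\<in>D'. v i = y i) \<longrightarrow> v \<notin> N)"
      using D'(1) by (intro exI[of _ D'] exI[of _ y] conjI)
  qed
next
  assume R: ?R
  have False if x: "x \<in> interior (closure N)" for x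
  proof -
    obtain D where D: "finite D" "{v. \<forall>i\<in>D. v i = x i} \<subseteq> interior (closure N)"
      using open_contains_cylinder[OF open_interior x] .
    from R[rule_format, OF D(1), of x]
    obtain D' y where y: "finite D'" "\<forall>i\<in>D. y i = x i" "\<forall>v. (\<forall>i\<in>D'. v i = y i) \<longrightarrow> v \<notin> N"
      by (elim exE conjE) simp
    let ?C = "{v. \<forall>i\<in>D'. v i = y i}"
    have "y \<in> closure N"
      using D(2) y(2) interior_subset by blast
    then have "?C \<inter> closure N \<noteq> {}"
      by auto
    moreover have "?C \<inter> N = {}"
      using y(3) by auto
    ultimately show False
      using open_Int_closure_eq_empty[OF open_cylinder[OF y(1)]] by simp
  qed
  then show "nowhere_dense N"
    by (auto simp: nowhere_dense_def)
qed

lemma nowhere_dense_finite_Union: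
  fixes N :: "nat \<Rightarrow> 'a::topological_space set"
  assumes "\<And>n. nowhere_dense (N n)"
  shows "nowhere_dense (\<Union>n\<le>m. N n)"
proof (induction m)
  case 0
  then show ?case
    using assms by simp
next
  case (Suc m)
  then show ?case
    using assms[of "Suc m"]
    by (simp add: nowhere_dense_def atMost_Suc interior_closed_Un_empty_interior)
qed

text \<open>A pattern that avoids \<open>N\<close> can be placed outside any finite
  \<open>D\<close>, whatever the values on \<open>D\<close> are: the finitely many possible
  restrictions to \<open>D\<close>, coded as subsets of \<open>D\<close>, are treated one after
  another, each enlarging the pattern.\<close>

lemma nowhere_dense_avoid:
  fixes N :: "(nat \<Rightarrow> bool) set"
  assumes N: "nowhere_dense N" and D: "finite D"
  shows "\<exists>J z. finite J \<and> J \<inter> D = {} \<and> (\<forall>v. (\<forall>i\<in>J. v i = z i) \<longrightarrow> v \<notin> N)"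
proof -
  have step: "\<exists>J z. finite J \<and> J \<inter> D = {} \<and>
      (\<forall>v. (\<forall>i\<in>J. v i = z i) \<and> {i\<in>D. v i} \<in> \<P> \<longrightarrow> v \<notin> N)" if "finite \<P>" for \<P>
    using that
  proof induction
    case empty
    show ?case
      by (rule exI[of _ "{}"]) simp
  next
    case (insert s \<P>)
    from insert.IH obtain J z where J: "finite J" "J \<inter> D = {}"
      "\<forall>v. (\<forall>i\<in>J. v i = z i) \<and> {i\<in>D. v i} \<in> \<P> \<longrightarrow> v \<notin> N"
      by (elim exE conjE)
    \<comment> \<open>On \<open>D\<close> the new restriction \<open>s\<close>, elsewhere the
      pattern reached so far. Hence \<open>y\<close> extends that pattern, and restrictions already
      treated stay treated.\<close>
    define x where "x i = (if i \<in> D then i \<in> s else z i)" for i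
    from N[unfolded nowhere_dense_cantor_iff, rule_format, OF finite_UnI[OF J(1) D], of x]
    obtain D' y where y: "finite D'" "\<forall>i\<in>J \<union> D. y i = x i" "\<forall>v. (\<forall>i\<in>D'. v i = y i) \<longrightarrow> v \<notin> N"
      by (elim exE conjE) simp
    have avoid: "v \<notin> N" if v: "\<forall>i\<in>J \<union> D' - D. v i = y i" "{i\<in>D. v i} \<in> insert s \<P>" for v
    proof (cases "{i\<in>D. v i} \<in> \<P>")
      case True
      have "v i = z i" if "i \<in> J" for i
      proof -
        have "i \<notin> D"
          using that J(2) by blast
        then show ?thesis
          using v(1) y(2) that by (simp add: x_def)
      qed
      then show ?thesis
        using J(3) True by simp
    next
      case False
      then have "{i\<in>D. v i} = s"
        using v(2) by simp
      then have "v i = y i" if "i \<in> D" for i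
        using y(2) that by (auto simp: x_def)
      then have "\<forall>i\<in>D'. v i = y i"
        using v(1) by blast
      then show ?thesis
        using y(3) by blast
    qed
    show ?case
    proof (intro exI[of _ "J \<union> D' - D"] exI[of _ y] conjI allI impI)
      show "finite (J \<union> D' - D)"
        using J(1) y(1) by simp
      show "(J \<union> D' - D) \<inter> D = {}"
        by blast
      show "v \<notin> N" if "(\<forall>i\<in>J \<union> D' - D. v i = y i) \<and> {i\<in>D. v i} \<in> insert s \<P>" for v
        by (rule avoid[OF conjunct1[OF that] conjunct2[OF that]])
    qed
  qed
  obtain J z where J: "finite J" "J \<inter> D = {}"
    "\<forall>v. (\<forall>i\<in>J. v i = z i) \<and> {i\<in>D. v i} \<in> Pow D \<longrightarrow> v \<notin> N"
    using step[OF finite_Pow_iff[THEN iffD2, OF D]] by (elim exE conjE)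
  have "v \<notin> N" if "\<forall>i\<in>J. v i = z i" for v
  proof (rule J(3)[rule_format], rule conjI[OF that])
    show "{i\<in>D. v i} \<in> Pow D"
      by simp
  qed
  then show ?thesis
    using J(1,2) by blast
qed

section \<open>Matching sets and their codes\<close>

text \<open>The block \<open>J m\<close> carries a pattern that avoids the first
  \<open>m + 1\<close> nowhere dense sets at once, so a point of \<open>N n\<close> can follow
  \<open>z\<close> on \<open>J m\<close> only for \<open>m < n\<close>.\<close>

lemma meagre_subset_matching:
  fixes M :: "(nat \<Rightarrow> bool) set"
  assumes "meagre M"
  shows "\<exists>(J :: nat \<Rightarrow> nat set) z. (\<forall>m. finite (J m)) \<and> (\<forall>m n. m \<noteq> n \<longrightarrow> J m \<inter> J n = {}) \<and>
    (\<forall>x\<in>M. \<forall>\<^sub>\<infinity>m. \<exists>i\<in>J m. x i \<noteq> z i)"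
proof -
  obtain N :: "nat \<Rightarrow> (nat \<Rightarrow> bool) set"
    where N: "\<And>n. nowhere_dense (N n)" and M: "M = (\<Union>n. N n)"
    using assms unfolding meagre_def by blast
  define Q where "Q m J \<longleftrightarrow> (\<exists>z. \<forall>v. (\<forall>i\<in>J. v i = z i) \<longrightarrow> v \<notin> (\<Union>n\<le>m. N n))" for m J
  have "\<exists>J. finite J \<and> J \<inter> D = {} \<and> Q m J" if "finite D" for m D
    using nowhere_dense_avoid[OF nowhere_dense_finite_Union[of N m, OF N] that]
    unfolding Q_def by blast
  from disjoint_sequence[of Q, OF this] obtain J where J: "\<And>m. finite (J m)" "\<And>m. Q m (J m)"
    "\<And>m n. m \<noteq> n \<Longrightarrow> J m \<inter> J n = {}"
    by blast
  obtain z where z: "\<And>m v. (\<forall>i\<in>J m. v i = z m i) \<Longrightarrow> v \<notin> (\<Union>n\<le>m. N n)"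
    using J(2) unfolding Q_def by metis
  \<comment> \<open>As the blocks are disjoint, the patterns glue to a single function; outside the
    blocks its value is arbitrary.\<close>
  define z' where "z' i = z (THE m. i \<in> J m) i" for i
  have z': "z' i = z m i" if "i \<in> J m" for i m
  proof -
    have "(THE m. i \<in> J m) = m"
      using J(3) that by (intro the_equality) blast+
    then show ?thesis
      by (simp add: z'_def)
  qed
  have "\<forall>\<^sub>\<infinity>m. \<exists>i\<in>J m. x i \<noteq> z' i" if x: "x \<in> M" for x
  proof -
    obtain n where n: "x \<in> N n"
      using x M by blast
    have "\<exists>i\<in>J m. x i \<noteq> z' i" if "m \<ge> n" for m
      using z[of m x] n that z'[of _ m] by auto
    then show ?thesis
      unfolding MOST_nat_le by blast
  qed
  then show ?thesis
    using J(1,3) by blast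
qed

text \<open>Given a cylinder, some late \<open>S n\<close> misses its finite support. Prescribing
  \<open>t\<close> there yields a smaller cylinder outside the set.\<close>

lemma meagre_matching:
  fixes S :: "nat \<Rightarrow> nat set"
  assumes S: "\<And>n. finite (S n)" "\<And>n. S n \<noteq> {}" and disj: "\<And>m n. m \<noteq> n \<Longrightarrow> S m \<inter> S n = {}"
  shows "meagre {x :: nat \<Rightarrow> bool. \<forall>\<^sub>\<infinity>n. \<exists>i\<in>S n. x i \<noteq> t i}"
  unfolding meagre_def
proof (intro exI[of _ "\<lambda>k. {x. \<forall>n\<ge>k. \<exists>i\<in>S n. x i \<noteq> t i}"] conjI allI)
  show "{x. \<forall>\<^sub>\<infinity>n. \<exists>i\<in>S n. x i \<noteq> t i} = (\<Union>k. {x. \<forall>n\<ge>k. \<exists>i\<in>S n. x i \<noteq> t i})"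
    unfolding MOST_nat_le by blast
  show "nowhere_dense {x. \<forall>n\<ge>k. \<exists>i\<in>S n. x i \<noteq> t i}" for k
    unfolding nowhere_dense_cantor_iff
  proof (intro allI impI)
    fix D :: "nat set" and x assume "finite D"
    obtain l where "\<And>n. n \<ge> l \<Longrightarrow> S n \<inter> D = {}"
      using disjoint_from_finite[of S, OF disj \<open>finite D\<close>] unfolding MOST_nat_le by blast
    then obtain n where n: "n \<ge> k" "S n \<inter> D = {}"
      using max.cobounded1 max.cobounded2 by blast
    define y where "y i = (if i \<in> S n then t i else x i)" for i
    have "\<forall>i\<in>D. y i = x i"
      using n(2) by (auto simp: y_def)
    moreover have "\<forall>v. (\<forall>i\<in>S n. v i = y i) \<longrightarrow> v \<notin> {x. \<forall>n\<ge>k. \<exists>i\<in>S n. x i \<noteq> t i}"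
      using n(1) by (auto simp: y_def)
    ultimately show "\<exists>D' y. finite D' \<and> (\<forall>i\<in>D. y i = x i) \<and>
        (\<forall>v. (\<forall>i\<in>D'. v i = y i) \<longrightarrow> v \<notin> {x. \<forall>n\<ge>k. \<exists>i\<in>S n. x i \<noteq> t i})"
      using S(1)[of n] by (intro exI[of _ "S n"] exI[of _ y] conjI)
  qed
qed

text \<open>Otherwise let \<open>x\<close> copy \<open>z\<close> on sparse bad blocks
  \<open>J m\<close> and negate \<open>t\<close> elsewhere. Then \<open>x\<close> differs from
  \<open>t\<close> on every \<open>S n\<close> but follows \<open>z\<close> on infinitely many
  blocks, against \<open>cover\<close>.\<close>

lemma matching_capture:
  fixes S J :: "nat \<Rightarrow> nat set" and t z :: "nat \<Rightarrow> bool"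
  assumes S: "\<And>n. finite (S n)" "\<And>n. S n \<noteq> {}" "\<And>m n. m \<noteq> n \<Longrightarrow> S m \<inter> S n = {}"
    and J: "\<And>m. finite (J m)" "\<And>m n. m \<noteq> n \<Longrightarrow> J m \<inter> J n = {}"
    and cover: "\<And>x. (\<forall>\<^sub>\<infinity>n. \<exists>i\<in>S n. x i \<noteq> t i) \<Longrightarrow> (\<forall>\<^sub>\<infinity>m. \<exists>i\<in>J m. x i \<noteq> z i)"
  shows "\<forall>\<^sub>\<infinity>m. \<exists>n. S n \<subseteq> J m \<and> (\<forall>i\<in>S n. z i = t i)"
proof (rule ccontr)
  define bad where "bad m \<longleftrightarrow> \<not> (\<exists>n. S n \<subseteq> J m \<and> (\<forall>i\<in>S n. z i = t i))" for m
  assume "\<not> (\<forall>\<^sub>\<infinity>m. \<exists>n. S n \<subseteq> J m \<and> (\<forall>i\<in>S n. z i = t i))"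
  then have bad: "\<exists>\<^sub>\<infinity>m. bad m"
    by (simp add: bad_def)
  \<comment> \<open>Bad indices so sparse that each \<open>S n\<close> meets at most one of the corresponding sets \<open>J m\<close>: the
    sequence chooses \<open>J m\<close> together with all \<open>S n\<close> that meet it.\<close>
  define sat where "sat m = J m \<union> (\<Union>n\<in>{n. S n \<inter> J m \<noteq> {}}. S n)" for m
  have "\<exists>A. finite A \<and> A \<inter> D = {} \<and> (\<exists>m\<ge>k. bad m \<and> A = sat m)" if "finite D" for k D
  proof -
    \<comment> \<open>If \<open>J m\<close> misses this enlargement of \<open>D\<close>, no
      \<open>S n\<close> meets both \<open>J m\<close> and \<open>D\<close>, so even
      \<open>sat m\<close> misses \<open>D\<close>.\<close>
    let ?D = "D \<union> (\<Union>n\<in>{n. S n \<inter> D \<noteq> {}}. S n)"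
    have fin: "finite (A \<union> (\<Union>n\<in>{n. S n \<inter> A \<noteq> {}}. S n))" if "finite A" for A
    proof -
      have "finite {n. S n \<inter> A \<noteq> {}}"
        using disjoint_from_finite[of S, OF S(3) that] by (simp add: eventually_cofinite)
      then show ?thesis
        using S(1) that by auto
    qed
    have "\<forall>\<^sub>\<infinity>m. J m \<inter> ?D = {}"
      by (rule disjoint_from_finite[OF J(2) fin[OF that]])
    moreover have "\<forall>\<^sub>\<infinity>m. m \<ge> k"
      unfolding MOST_nat_le by blast
    ultimately have "\<forall>\<^sub>\<infinity>m. J m \<inter> ?D = {} \<and> m \<ge> k"
      by (rule eventually_conj)
    from INFM_EX[OF INFM_conjI[OF bad this]]
    obtain m where m: "bad m" "J m \<inter> ?D = {}" "m \<ge> k"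
      by blast
    have "sat m \<inter> D = {}"
      using m(2) unfolding sat_def by blast
    moreover have "finite (sat m)"
      unfolding sat_def by (rule fin[OF J(1)])
    ultimately show ?thesis
      using m by blast
  qed
  from disjoint_sequence[of "\<lambda>k A. \<exists>m\<ge>k. bad m \<and> A = sat m", OF this] obtain A
    where A: "\<And>k. \<exists>m\<ge>k. bad m \<and> A k = sat m" "\<And>k l. k \<noteq> l \<Longrightarrow> A k \<inter> A l = {}"
    by blast
  obtain \<mu> where \<mu>: "\<And>k. \<mu> k \<ge> k" "\<And>k. bad (\<mu> k)" "\<And>k. A k = sat (\<mu> k)"
    using A(1) by metis
  define x where "x i = (if \<exists>k. i \<in> J (\<mu> k) then z i else \<not> t i)" for i
  have "\<exists>i\<in>S n. x i \<noteq> t i" for n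
  proof (cases "\<exists>k. S n \<subseteq> J (\<mu> k)")
    case True
    then obtain k where k: "S n \<subseteq> J (\<mu> k)" ..
    then obtain i where "i \<in> S n" "z i \<noteq> t i"
      using \<mu>(2)[of k] unfolding bad_def by blast
    then show ?thesis
      using k by (auto simp: x_def)
  next
    case False
    \<comment> \<open>If \<open>S n\<close> meets \<open>J (\<mu> k)\<close>, it lies in
      \<open>A k\<close> and so misses all other chosen blocks; not being contained in
      \<open>J (\<mu> k)\<close>, it has a point outside all of them.\<close>
    have "\<exists>i\<in>S n. \<forall>k. i \<notin> J (\<mu> k)"
    proof (cases "\<exists>k. S n \<inter> J (\<mu> k) \<noteq> {}")
      case True
      then obtain k where k: "S n \<inter> J (\<mu> k) \<noteq> {}" ..
      then have "S n \<subseteq> A k"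
        by (auto simp: \<mu>(3) sat_def)
      then have "S n \<inter> J (\<mu> l) = {}" if "l \<noteq> k" for l
        using A(2)[OF that] by (auto simp: \<mu>(3)[of l] sat_def)
      moreover obtain i where "i \<in> S n" "i \<notin> J (\<mu> k)"
        using False by blast
      ultimately have "i \<notin> J (\<mu> l)" for l
        by (cases "l = k") auto
      then show ?thesis
        using \<open>i \<in> S n\<close> by blast
    qed (use S(2)[of n] in blast)
    then show ?thesis
      by (auto simp: x_def)
  qed
  then have "\<forall>\<^sub>\<infinity>m. \<exists>i\<in>J m. x i \<noteq> z i"
    using cover by simp
  then obtain m where "\<And>l. l \<ge> m \<Longrightarrow> \<exists>i\<in>J l. x i \<noteq> z i"
    unfolding MOST_nat_le by blast
  then obtain i where "i \<in> J (\<mu> m)" "x i \<noteq> z i"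
    using \<mu>(1) by blast
  then show False
    unfolding x_def by metis
qed

text \<open>The meagre set given by \<open>(S, t)\<close> lies in some \<open>g w\<close>, which
  lies in the matching set of the code of \<open>w\<close>. Codes are indexed by \<open>W\<close>,
  which will also index the basis, so that a code can be required to come before a basis
  vector.\<close>

lemma cofinal_meagre_matching:
  assumes "cofinal_in {A :: (nat \<Rightarrow> bool) set. meagre A} (g ` W)"
  shows "\<exists>(J :: 'w \<Rightarrow> nat \<Rightarrow> nat set) (z :: 'w \<Rightarrow> nat \<Rightarrow> bool).
    (\<forall>w\<in>W. (\<forall>m. finite (J w m)) \<and> (\<forall>m n. m \<noteq> n \<longrightarrow> J w m \<inter> J w n = {})) \<and>
    (\<forall>(S :: nat \<Rightarrow> nat set) t. (\<forall>n. finite (S n) \<and> S n \<noteq> {}) \<longrightarrow>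
      (\<forall>m n. m \<noteq> n \<longrightarrow> S m \<inter> S n = {}) \<longrightarrow>
      (\<exists>w\<in>W. \<forall>\<^sub>\<infinity>m. \<exists>n. S n \<subseteq> J w m \<and> (\<forall>i\<in>S n. z w i = t i)))"
proof -
  have meagre: "meagre (g w)" if "w \<in> W" for w
    using assms that by (auto simp: cofinal_in_def)
  have "\<forall>w\<in>W. \<exists>(J :: nat \<Rightarrow> nat set) z. (\<forall>m. finite (J m)) \<and> (\<forall>m n. m \<noteq> n \<longrightarrow> J m \<inter> J n = {}) \<and>
      (\<forall>x\<in>g w. \<forall>\<^sub>\<infinity>m. \<exists>i\<in>J m. x i \<noteq> z i)"
    by (intro ballI meagre_subset_matching meagre)
  from bchoice[OF this] obtain J :: "'w \<Rightarrow> nat \<Rightarrow> nat set" where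
    "\<forall>w\<in>W. \<exists>z. (\<forall>m. finite (J w m)) \<and> (\<forall>m n. m \<noteq> n \<longrightarrow> J w m \<inter> J w n = {}) \<and>
      (\<forall>x\<in>g w. \<forall>\<^sub>\<infinity>m. \<exists>i\<in>J w m. x i \<noteq> z i)" ..
  from bchoice[OF this] obtain z where Jz: "\<And>w. w \<in> W \<Longrightarrow> (\<forall>m. finite (J w m)) \<and>
      (\<forall>m n. m \<noteq> n \<longrightarrow> J w m \<inter> J w n = {}) \<and> (\<forall>x\<in>g w. \<forall>\<^sub>\<infinity>m. \<exists>i\<in>J w m. x i \<noteq> z w i)"
    by blast
  show ?thesis
  proof (intro exI[of _ J] exI[of _ z] conjI[OF ballI] allI impI)
    show "(\<forall>m. finite (J w m)) \<and> (\<forall>m n. m \<noteq> n \<longrightarrow> J w m \<inter> J w n = {})" if "w \<in> W" for w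
      using Jz[OF that] by blast
  next
    fix S :: "nat \<Rightarrow> nat set" and t :: "nat \<Rightarrow> bool"
    assume *: "\<forall>n. finite (S n) \<and> S n \<noteq> {}" "\<forall>m n. m \<noteq> n \<longrightarrow> S m \<inter> S n = {}"
    then have S: "\<And>n. finite (S n)" "\<And>n. S n \<noteq> {}" "\<And>m n. m \<noteq> n \<Longrightarrow> S m \<inter> S n = {}"
      by blast+
    obtain w where w: "w \<in> W" "{x. \<forall>\<^sub>\<infinity>n. \<exists>i\<in>S n. x i \<noteq> t i} \<subseteq> g w"
      using assms meagre_matching[of S t, OF S] unfolding cofinal_in_def by blast
    have "\<forall>\<^sub>\<infinity>m. \<exists>n. S n \<subseteq> J w m \<and> (\<forall>i\<in>S n. z w i = t i)"
      by (rule matching_capture[OF S]) (use Jz[OF w(1)] w(2) in auto)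
    then show "\<exists>w\<in>W. \<forall>\<^sub>\<infinity>m. \<exists>n. S n \<subseteq> J w m \<and> (\<forall>i\<in>S n. z w i = t i)"
      using w(1) by blast
  qed
qed

section \<open>Functions meeting countably many requirements\<close>

lemma generic_function:
  fixes A :: "'r \<Rightarrow> nat \<Rightarrow> 'a set" and g :: "'r \<Rightarrow> 'a \<Rightarrow> 'b"
  assumes R: "countable R"
    and fin: "\<And>\<rho> m. \<rho> \<in> R \<Longrightarrow> finite (A \<rho> m)"
    and disj: "\<And>\<rho> m n. \<rho> \<in> R \<Longrightarrow> m \<noteq> n \<Longrightarrow> A \<rho> m \<inter> A \<rho> n = {}"
  shows "\<exists>f. \<forall>\<rho>\<in>R. \<exists>\<^sub>\<infinity>m. \<forall>i\<in>A \<rho> m. f i = g \<rho> i"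
proof (cases "R = {}")
  case False
  \<comment> \<open>A schedule of all pairs \<open>(\<rho>, k)\<close>. Stage \<open>q\<close>
    serves its pair by a fresh block \<open>A \<rho> m\<close> with \<open>m \<ge> k\<close>; since
    every \<open>k\<close> occurs with \<open>\<rho>\<close>, this happens for infinitely many
    \<open>m\<close>.\<close>
  define \<tau> where "\<tau> = from_nat_into (R \<times> (UNIV :: nat set))"
  have \<tau>: "range \<tau> = R \<times> UNIV"
    unfolding \<tau>_def using False R by (intro range_from_nat_into) auto
  have "\<exists>B. finite B \<and> B \<inter> D = {} \<and> (\<exists>m\<ge>snd (\<tau> q). B = A (fst (\<tau> q)) m)" if D: "finite D" for q D
  proof -
    have \<rho>: "fst (\<tau> q) \<in> R"
      using \<tau> rangeI[of \<tau> q] by (auto simp: mem_Times_iff)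
    obtain l where "\<And>m. m \<ge> l \<Longrightarrow> A (fst (\<tau> q)) m \<inter> D = {}"
      using disjoint_from_finite[of "A (fst (\<tau> q))", OF disj[OF \<rho>] D]
      unfolding MOST_nat_le by blast
    then obtain m where "m \<ge> snd (\<tau> q)" "A (fst (\<tau> q)) m \<inter> D = {}"
      using max.cobounded1 max.cobounded2 by blast
    then show ?thesis
      using fin[OF \<rho>] by blast
  qed
  from disjoint_sequence[of "\<lambda>q B. \<exists>m\<ge>snd (\<tau> q). B = A (fst (\<tau> q)) m", OF this] obtain B
    where B: "\<And>q. \<exists>m\<ge>snd (\<tau> q). B q = A (fst (\<tau> q)) m" "\<And>p q. p \<noteq> q \<Longrightarrow> B p \<inter> B q = {}"
    by blast
  define f where "f i = g (fst (\<tau> (THE q. i \<in> B q))) i" for i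
  have f: "f i = g (fst (\<tau> q)) i" if "i \<in> B q" for i q
  proof -
    have "(THE q. i \<in> B q) = q"
      using B(2) that by (intro the_equality) blast+
    then show ?thesis
      by (simp add: f_def)
  qed
  have "\<exists>\<^sub>\<infinity>m. \<forall>i\<in>A \<rho> m. f i = g \<rho> i" if \<rho>: "\<rho> \<in> R" for \<rho>
    unfolding INFM_nat_le
  proof
    fix k
    obtain q where "\<tau> q = (\<rho>, k)"
      using \<tau> \<rho> by (metis UNIV_I mem_Sigma_iff rangeE)
    then show "\<exists>m\<ge>k. \<forall>i\<in>A \<rho> m. f i = g \<rho> i"
      using B(1)[of q] f[of _ q] by auto
  qed
  then show ?thesis
    by blast
qed simp

abbreviation "keys \<equiv> Poly_Mapping.keys"

abbreviation "lookup \<equiv> Poly_Mapping.lookup"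

section \<open>Well-orders of type \<open>\<omega>\<^sub>1\<close>\<close>

text \<open>An order of type \<open>\<omega>\<^sub>1\<close> on a set of an arbitrary type, given by
  its strict part because the matrix is built by well-founded recursion along
  \<open>lt\<close>.\<close>

locale aleph1_order =
  fixes W :: "'a set" and lt :: "'a rel"
  assumes wf_lt: "wf lt"
    and trans_lt: "trans lt"
    and lt_subset: "lt \<subseteq> W \<times> W"
    and total_lt: "\<lbrakk>v \<in> W; w \<in> W; v \<noteq> w\<rbrakk> \<Longrightarrow> (v, w) \<in> lt \<or> (w, v) \<in> lt"
    and countable_initial: "countable {v. (v, w) \<in> lt}"
    and uncountable_W: "uncountable W"
begin

definition below :: "'a \<Rightarrow> 'a set" where
  "below w = {v. (v, w) \<in> lt}"

lemma countable_below: "countable (below w)"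
  using countable_initial by (simp add: below_def)

lemma below_subset: "below w \<subseteq> W"
  using lt_subset by (auto simp: below_def)

lemma below_trans: "v \<in> below w \<Longrightarrow> w \<in> below u \<Longrightarrow> v \<in> below u"
  using trans_lt by (auto simp: below_def dest: transD)

lemma not_below_self: "w \<notin> below w"
  using wf_lt by (auto simp: below_def)

lemma below_asym: "v \<in> below w \<Longrightarrow> w \<notin> below v"
  using below_trans not_below_self by blast

lemma below_total: "v \<in> W \<Longrightarrow> w \<in> W \<Longrightarrow> v \<in> below w \<or> v = w \<or> w \<in> below v"
  using total_lt by (auto simp: below_def)

text \<open>Regularity of \<open>\<omega>\<^sub>1\<close>: countably many countable initial segments
  do not exhaust \<open>W\<close>.\<close>

lemma countable_bounded:
  assumes "countable C" "C \<subseteq> W"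
  shows "\<exists>w\<in>W. C \<subseteq> below w"
proof -
  have "countable (\<Union>c\<in>C. insert c (below c))"
    using assms(1) countable_below by auto
  then have "\<not> W \<subseteq> (\<Union>c\<in>C. insert c (below c))"
    using uncountable_W countable_subset by blast
  then obtain w where "w \<in> W" "\<And>c. c \<in> C \<Longrightarrow> w \<noteq> c \<and> w \<notin> below c"
    by blast
  then show ?thesis
    using below_total assms(2) by blast
qed

lemma finite_has_top:
  assumes "finite K" "K \<noteq> {}" "K \<subseteq> W"
  shows "\<exists>\<gamma>\<in>K. K \<subseteq> insert \<gamma> (below \<gamma>)"
  using assms
proof (induction K rule: finite_ne_induct)
  case (insert k K)
  then obtain \<gamma> where \<gamma>: "\<gamma> \<in> K" "K \<subseteq> insert \<gamma> (below \<gamma>)"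
    by auto
  consider "k \<in> below \<gamma>" | "k = \<gamma>" | "\<gamma> \<in> below k"
    using below_total[of k \<gamma>] insert.prems \<gamma>(1) by blast
  then show ?case
  proof cases
    case 3
    then have "insert k K \<subseteq> insert k (below k)"
      using \<gamma>(2) below_trans by blast
    then show ?thesis
      by blast
  qed (use \<gamma> in auto)
qed simp

end

text \<open>The cardinal order \<open>|W|\<close> is a well-order whose proper initial segments have
  smaller cardinality, which below the successor of \<open>natLeq\<close> means countable.\<close>

lemma aleph1_order_exists:
  fixes W :: "'a set"
  assumes W: "|W| =o cardSuc natLeq"
  obtains lt where "aleph1_order W lt"
proof -
  have countable_iff: "countable A \<longleftrightarrow> |A| <o cardSuc natLeq" for A :: "'a set"
    by (simp add: countable_card_le_natLeq
        cardSuc_ordLeq_ordLess[OF natLeq_Card_order card_of_Card_order])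
  define r where "r = |W|"
  have r: "Card_order r" "Field r = W"
    unfolding r_def by (rule card_of_Card_order Field_card_of)+
  have "well_order_on W r"
    unfolding r_def by (rule card_of_well_order_on)
  then have lin: "linear_order_on W r" and wf: "wf (r - Id)"
    by (simp_all add: well_order_on_def)
  have order: "refl_on W r" "trans r" "antisym r" "total_on W r" "r \<subseteq> W \<times> W"
    using lin by (auto simp: linear_order_on_def partial_order_on_def preorder_on_def)
  have "aleph1_order W (r - Id)"
  proof
    show "wf (r - Id)"
      by fact
    show "trans (r - Id)"
      using order(2,3) by (rule trans_diff_Id)
    show "r - Id \<subseteq> W \<times> W"
      using order(5) by blast
    show "(v, w) \<in> r - Id \<or> (w, v) \<in> r - Id" if "v \<in> W" "w \<in> W" "v \<noteq> w" for v w
      using order(4) that by (auto simp: total_on_def)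
    show "countable {v. (v, w) \<in> r - Id}" for w
    proof (cases "w \<in> W")
      case True
      have "{v. (v, w) \<in> r - Id} = underS r w"
        by (auto simp: underS_def)
      then have "|{v. (v, w) \<in> r - Id}| <o r"
        using card_of_underS[OF r(1)] True r(2) by simp
      then show ?thesis
        using W ordLess_ordIso_trans unfolding countable_iff r_def by blast
    next
      case False
      then have "{v. (v, w) \<in> r - Id} = {}"
        using order(5) by auto
      then show ?thesis
        by (metis countable_empty)
    qed
    show "uncountable W"
      using W not_ordLess_ordIso unfolding countable_iff by blast
  qed
  then show thesis
    by (rule that)
qed

section \<open>A generic symmetric matrix\<close>

text \<open>A vector is determined by the finite graph of its nonzero values, a finite subset of
  \<open>L\<close> times the finite field.\<close>

lemma countable_keys_subset:
  assumes "countable L"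
  shows "countable {x :: 'a \<Rightarrow>\<^sub>0 'k::{zero,finite}. keys x \<subseteq> L}"
proof -
  define gr where "gr x = (\<lambda>i. (i, lookup x i)) ` keys x" for x :: "'a \<Rightarrow>\<^sub>0 'k"
  have "inj gr"
  proof
    fix x y :: "'a \<Rightarrow>\<^sub>0 'k"
    assume eq: "gr x = gr y"
    have graph: "c \<noteq> 0 \<Longrightarrow> (i, c) \<in> gr z \<longleftrightarrow> lookup z i = c" for i c and z :: "'a \<Rightarrow>\<^sub>0 'k"
      by (auto simp: gr_def in_keys_iff)
    have "lookup x i = lookup y i" for i
      using graph[of "lookup x i" i x] graph[of "lookup x i" i y]
        graph[of "lookup y i" i x] graph[of "lookup y i" i y] eq by metis
    then show "x = y"
      by (rule poly_mapping_eqI)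
  qed
  have "countable (L \<times> (UNIV :: 'k set))"
    using assms by (simp add: countable_finite)
  then have "countable {A. finite A \<and> A \<subseteq> L \<times> (UNIV :: 'k set)}"
    by (rule countable_Collect_finite_subset)
  moreover have "gr ` {x. keys x \<subseteq> L} \<subseteq> {A. finite A \<and> A \<subseteq> L \<times> UNIV}"
    by (auto simp: gr_def)
  ultimately have "countable (gr ` {x. keys x \<subseteq> L})"
    using countable_subset by blast
  then show ?thesis
    by (rule countable_image_inj_on) (use \<open>inj gr\<close> in \<open>auto intro: inj_on_subset\<close>)
qed

text \<open>Stage \<open>\<gamma>\<close> chooses the entries \<open>G \<gamma> i\<close> with
  \<open>i\<close> below \<open>\<gamma>\<close>. If \<open>x\<close> has top index
  \<open>\<gamma>\<close>, the remaining terms of the sum are known by then and the coefficient at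
  \<open>\<gamma>\<close> is invertible, so a prescribed value of the sum is a prescribed value of
  \<open>G \<gamma> i\<close>. The triples \<open>(\<alpha>, \<xi>, x)\<close> are countably many,
  hence \<open>generic_function\<close> applies.\<close>

lemma (in aleph1_order) generic_matrix:
  fixes e :: "'a \<Rightarrow> 'a \<Rightarrow> nat" and J :: "'a \<Rightarrow> nat \<Rightarrow> nat set" and z :: "'a \<Rightarrow> nat \<Rightarrow> bool"
  assumes e: "\<And>\<alpha>. inj_on (e \<alpha>) (below \<alpha>)"
    and J: "\<forall>\<xi>\<in>W. (\<forall>m. finite (J \<xi> m)) \<and> (\<forall>m n. m \<noteq> n \<longrightarrow> J \<xi> m \<inter> J \<xi> n = {})"
  shows "\<exists>G :: 'a \<Rightarrow> 'a \<Rightarrow> 'k::{field,finite}. (\<forall>i j. G i j = G j i) \<and>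
    (\<forall>\<gamma> \<alpha> \<xi> x. \<alpha> \<in> below \<gamma> \<and> \<xi> \<in> below \<gamma> \<and> \<gamma> \<in> keys x \<and> keys x \<subseteq> insert \<gamma> (below \<gamma>) \<longrightarrow>
      (\<exists>\<^sub>\<infinity>m. \<forall>i\<in>below \<alpha>. e \<alpha> i \<in> J \<xi> m \<longrightarrow>
        (\<Sum>j\<in>keys x. lookup x j * G j i) = of_bool (z \<xi> (e \<alpha> i))))"
proof -
  \<comment> \<open>The entry at a pair is read from the row of the larger index, which makes the
    matrix symmetric; the diagonal is 0.\<close>
  define G :: "('a \<Rightarrow> 'a \<Rightarrow> 'k) \<Rightarrow> 'a \<Rightarrow> 'a \<Rightarrow> 'k"
    where "G f i j = (if j \<in> below i then f i j else if i \<in> below j then f j i else 0)" for f i j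
  define adm where "adm \<gamma> = (\<lambda>(\<alpha>, \<xi>, x :: 'a \<Rightarrow>\<^sub>0 'k).
    \<alpha> \<in> below \<gamma> \<and> \<xi> \<in> below \<gamma> \<and> \<gamma> \<in> keys x \<and> keys x \<subseteq> insert \<gamma> (below \<gamma>))" for \<gamma>
  define lower where "lower f \<gamma> x i = (\<Sum>j\<in>keys x - {\<gamma>}. lookup x j * G f j i)" for f \<gamma> x i
  define P where "P f \<gamma> r \<longleftrightarrow> (\<forall>(\<alpha>, \<xi>, x) \<in> {\<rho>. adm \<gamma> \<rho>}.
    \<exists>\<^sub>\<infinity>m. \<forall>i\<in>below \<alpha>. e \<alpha> i \<in> J \<xi> m \<longrightarrow>
      lookup x \<gamma> * r i + lower f \<gamma> x i = of_bool (z \<xi> (e \<alpha> i)))" for f \<gamma> r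
  have "\<exists>f. \<forall>\<gamma>. P f \<gamma> (f \<gamma>)"
  proof (rule dependent_wf_choice[OF wf_lt])
    fix f g :: "'a \<Rightarrow> 'a \<Rightarrow> 'k" and \<gamma> and r :: "'a \<Rightarrow> 'k"
    assume agree: "f w = g w" if "(w, \<gamma>) \<in> lt" for w
    \<comment> \<open>Both indices of every entry in this sum are below \<open>\<gamma>\<close>, so
      only earlier rows enter.\<close>
    have lower: "lower f \<gamma> x i = lower g \<gamma> x i"
      if "adm \<gamma> (\<alpha>, \<xi>, x)" "i \<in> below \<alpha>" for \<alpha> \<xi> x i
      unfolding lower_def
    proof (rule sum.cong[OF refl])
      fix j assume "j \<in> keys x - {\<gamma>}"
      then have "j \<in> below \<gamma>" "i \<in> below \<gamma>"
        using that below_trans by (auto simp: adm_def)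
      then have "f j = g j" "f i = g i"
        using agree by (simp_all add: below_def)
      then show "lookup x j * G f j i = lookup x j * G g j i"
        by (simp add: G_def)
    qed
    have "(\<forall>i\<in>below \<alpha>. e \<alpha> i \<in> J \<xi> m \<longrightarrow>
        lookup x \<gamma> * r i + lower f \<gamma> x i = of_bool (z \<xi> (e \<alpha> i))) \<longleftrightarrow>
      (\<forall>i\<in>below \<alpha>. e \<alpha> i \<in> J \<xi> m \<longrightarrow>
        lookup x \<gamma> * r i + lower g \<gamma> x i = of_bool (z \<xi> (e \<alpha> i)))"
      if "adm \<gamma> (\<alpha>, \<xi>, x)" for \<alpha> \<xi> x m
      by (rule ball_cong[OF refl]) (simp only: lower[OF that])
    then show "P f \<gamma> r = P g \<gamma> r"
      unfolding P_def by (intro ball_cong[OF refl]) (auto simp: split_paired_all)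
  next
    fix \<gamma> and f :: "'a \<Rightarrow> 'a \<Rightarrow> 'k"
    define R where "R = {\<rho>. adm \<gamma> \<rho>}"
    define A where "A = (\<lambda>(\<alpha>, \<xi>, x :: 'a \<Rightarrow>\<^sub>0 'k) m. {i\<in>below \<alpha>. e \<alpha> i \<in> J \<xi> m})"
    \<comment> \<open>The solution \<open>r i\<close> of the linear equation in
      \<open>P\<close>.\<close>
    define g where "g = (\<lambda>(\<alpha>, \<xi>, x) i. (of_bool (z \<xi> (e \<alpha> i)) - lower f \<gamma> x i) / lookup x \<gamma>)"
    have "\<exists>r. \<forall>\<rho>\<in>R. \<exists>\<^sub>\<infinity>m. \<forall>i\<in>A \<rho> m. r i = g \<rho> i"
    proof (rule generic_function)
      have "R \<subseteq> below \<gamma> \<times> below \<gamma> \<times> {x. keys x \<subseteq> insert \<gamma> (below \<gamma>)}"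
        by (auto simp: R_def adm_def)
      moreover have "countable (below \<gamma> \<times> below \<gamma> \<times>
          {x :: 'a \<Rightarrow>\<^sub>0 'k. keys x \<subseteq> insert \<gamma> (below \<gamma>)})"
        by (intro countable_SIGMA countable_below countable_keys_subset countable_insert)
      ultimately show "countable R"
        by (rule countable_subset)
    next
      fix \<rho> m assume "\<rho> \<in> R"
      then obtain \<alpha> \<xi> x where \<rho>: "\<rho> = (\<alpha>, \<xi>, x)" "\<xi> \<in> below \<gamma>"
        by (cases \<rho>) (auto simp: R_def adm_def)
      then have "\<xi> \<in> W"
        using below_subset by blast
      have "A \<rho> m = e \<alpha> -` J \<xi> m \<inter> below \<alpha>"
        by (auto simp: A_def \<rho>(1))
      then show "finite (A \<rho> m)"
        using finite_vimage_IntI[OF _ e, of "J \<xi> m"] J \<open>\<xi> \<in> W\<close> by simp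
      show "A \<rho> m \<inter> A \<rho> n = {}" if "m \<noteq> n" for n
        using J \<open>\<xi> \<in> W\<close> that by (fastforce simp: A_def \<rho>(1))
    qed
    then obtain r where r: "\<And>\<rho>. \<rho> \<in> R \<Longrightarrow> \<exists>\<^sub>\<infinity>m. \<forall>i\<in>A \<rho> m. r i = g \<rho> i"
      by blast
    have "\<exists>\<^sub>\<infinity>m. \<forall>i\<in>below \<alpha>. e \<alpha> i \<in> J \<xi> m \<longrightarrow>
        lookup x \<gamma> * r i + lower f \<gamma> x i = of_bool (z \<xi> (e \<alpha> i))"
      if "adm \<gamma> (\<alpha>, \<xi>, x)" for \<alpha> \<xi> x
    proof (rule frequently_elim1)
      show "\<exists>\<^sub>\<infinity>m. \<forall>i\<in>A (\<alpha>, \<xi>, x) m. r i = g (\<alpha>, \<xi>, x) i"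
        using that by (intro r) (simp add: R_def)
    next
      fix m assume *: "\<forall>i\<in>A (\<alpha>, \<xi>, x) m. r i = g (\<alpha>, \<xi>, x) i"
      have "lookup x \<gamma> \<noteq> 0"
        using that by (simp add: adm_def in_keys_iff)
      then show "\<forall>i\<in>below \<alpha>. e \<alpha> i \<in> J \<xi> m \<longrightarrow>
          lookup x \<gamma> * r i + lower f \<gamma> x i = of_bool (z \<xi> (e \<alpha> i))"
        using * by (simp add: A_def g_def)
    qed
    then show "\<exists>r. P f \<gamma> r"
      unfolding P_def by (intro exI[of _ r]) auto
  qed
  then obtain f where f: "\<And>\<gamma>. P f \<gamma> (f \<gamma>)"
    by blast
  show ?thesis
  proof (intro exI[of _ "G f"] conjI allI impI)
    show "G f i j = G f j i" for i j
      using below_asym by (auto simp: G_def)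
  next
    fix \<gamma> \<alpha> \<xi> and x :: "'a \<Rightarrow>\<^sub>0 'k"
    assume "\<alpha> \<in> below \<gamma> \<and> \<xi> \<in> below \<gamma> \<and> \<gamma> \<in> keys x \<and> keys x \<subseteq> insert \<gamma> (below \<gamma>)"
    then have *: "\<alpha> \<in> below \<gamma>" "\<xi> \<in> below \<gamma>" "\<gamma> \<in> keys x" "keys x \<subseteq> insert \<gamma> (below \<gamma>)"
      by simp_all
    then have "adm \<gamma> (\<alpha>, \<xi>, x)"
      by (simp add: adm_def)
    then have "\<exists>\<^sub>\<infinity>m. \<forall>i\<in>below \<alpha>. e \<alpha> i \<in> J \<xi> m \<longrightarrow>
        lookup x \<gamma> * f \<gamma> i + lower f \<gamma> x i = of_bool (z \<xi> (e \<alpha> i))"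
      using f[of \<gamma>] unfolding P_def by blast
    moreover have "(\<Sum>j\<in>keys x. lookup x j * G f j i) = lookup x \<gamma> * f \<gamma> i + lower f \<gamma> x i"
      if "i \<in> below \<alpha>" for i
    proof -
      have "i \<in> below \<gamma>"
        using that *(1) by (rule below_trans)
      then show ?thesis
        using *(3) by (simp add: lower_def sum.remove[of "keys x" \<gamma>] G_def)
    qed
    ultimately show "\<exists>\<^sub>\<infinity>m. \<forall>i\<in>below \<alpha>. e \<alpha> i \<in> J \<xi> m \<longrightarrow>
        (\<Sum>j\<in>keys x. lookup x j * G f j i) = of_bool (z \<xi> (e \<alpha> i))"
      by simp
  qed
qed

section \<open>Finitely supported functions and forms given by matrices\<close>

definition pm_scale :: "'k::field \<Rightarrow> ('a \<Rightarrow>\<^sub>0 'k) \<Rightarrow> ('a \<Rightarrow>\<^sub>0 'k)" where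
  "pm_scale c = Poly_Mapping.map ((*) c)"

lemma lookup_pm_scale [simp]: "lookup (pm_scale c x) i = c * lookup x i"
  by (simp add: pm_scale_def map.rep_eq when_def)

lemma keys_pm_scale: "keys (pm_scale c x) \<subseteq> keys x"
  by (auto simp: in_keys_iff)

interpretation pm: vector_space pm_scale
  by unfold_locales (auto intro!: poly_mapping_eqI simp: lookup_add algebra_simps)

lemma subspace_keys: "pm.subspace {x :: 'a \<Rightarrow>\<^sub>0 'k::field. keys x \<subseteq> W}"
proof (rule pm.subspaceI)
  show "x + y \<in> {x. keys x \<subseteq> W}" if "x \<in> {x. keys x \<subseteq> W}" "y \<in> {x. keys x \<subseteq> W}"
    for x y :: "'a \<Rightarrow>\<^sub>0 'k"
    using that Poly_Mapping.keys_add[of x y] by auto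
  show "pm_scale c x \<in> {x. keys x \<subseteq> W}" if "x \<in> {x. keys x \<subseteq> W}"
    for c and x :: "'a \<Rightarrow>\<^sub>0 'k"
    using that keys_pm_scale[of c x] by auto
qed simp

text \<open>Independence: the unit vectors other than the one at \<open>w\<close> lie in the
  subspace of vectors vanishing at \<open>w\<close>.\<close>

lemma basis_of_keys:
  "basis_of pm_scale {x :: 'a \<Rightarrow>\<^sub>0 'k::field. keys x \<subseteq> W} ((\<lambda>w. Poly_Mapping.single w 1) ` W)"
  (is "basis_of _ ?E ?B")
  unfolding basis_of_def
proof (intro conjI)
  show sub: "?B \<subseteq> ?E"
    by auto
  show "pm.independent ?B"
    unfolding pm.dependent_def
  proof
    assume "\<exists>b\<in>?B. b \<in> pm.span (?B - {b})"
    then obtain w :: 'a where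
      w: "Poly_Mapping.single w 1 \<in> pm.span (?B - {Poly_Mapping.single w (1 :: 'k)})"
      by blast
    have "pm.subspace {x :: 'a \<Rightarrow>\<^sub>0 'k. lookup x w = 0}"
      by (rule pm.subspaceI) (auto simp: lookup_add)
    moreover have "?B - {Poly_Mapping.single w (1 :: 'k)} \<subseteq> {x. lookup x w = 0}"
      by (auto simp: lookup_single when_def)
    ultimately have "pm.span (?B - {Poly_Mapping.single w (1 :: 'k)}) \<subseteq> {x. lookup x w = 0}"
      by (intro pm.span_minimal)
    then show False
      using w by auto
  qed
  show "pm.span ?B = ?E"
  proof
    show "pm.span ?B \<subseteq> ?E"
      by (rule pm.span_minimal[OF sub subspace_keys])
    show "?E \<subseteq> pm.span ?B"
    proof
      fix x :: "'a \<Rightarrow>\<^sub>0 'k" assume "x \<in> ?E"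
      have "x = (\<Sum>w\<in>keys x. pm_scale (lookup x w) (Poly_Mapping.single w 1))"
      proof (rule poly_mapping_eqI)
        fix i
        have "(\<Sum>w\<in>keys x. lookup x w * lookup (Poly_Mapping.single w 1) i) =
            (\<Sum>w\<in>keys x. if w = i then lookup x w else 0)"
          by (rule sum.cong) (auto simp: lookup_single when_def)
        also have "\<dots> = lookup x i"
          by (simp add: in_keys_iff)
        finally show "lookup x i =
            lookup (\<Sum>w\<in>keys x. pm_scale (lookup x w) (Poly_Mapping.single w 1)) i"
          by (simp add: lookup_sum)
      qed
      also have "\<dots> \<in> pm.span ?B"
        using \<open>x \<in> ?E\<close> by (intro pm.span_sum pm.span_scale pm.span_base) auto
      finally show "x \<in> pm.span ?B" .
    qed
  qed
qed

lemma cdim_keys: "cdim pm_scale {x :: 'a \<Rightarrow>\<^sub>0 'k::field. keys x \<subseteq> W} =o |W|"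
proof -
  have "inj_on (\<lambda>w. Poly_Mapping.single w (1 :: 'k)) W"
    by (rule inj_onI) (metis lookup_single_eq lookup_single_not_eq zero_neq_one)
  then have "|W| =o |(\<lambda>w. Poly_Mapping.single w (1 :: 'k)) ` W|"
    by (intro card_of_ordIsoI bij_betw_imageI) auto
  then show ?thesis
    using pm.cdim_eq_card_basis[OF basis_of_keys] ordIso_symmetric ordIso_transitive by blast
qed

text \<open>The inner sum is the value of the form at \<open>x\<close> and the unit vector at
  \<open>i\<close>, the quantity that \<open>generic_matrix\<close> controls.\<close>

definition matrix_form :: "('a \<Rightarrow> 'a \<Rightarrow> 'k::field) \<Rightarrow> ('a \<Rightarrow>\<^sub>0 'k) \<Rightarrow> ('a \<Rightarrow>\<^sub>0 'k) \<Rightarrow> 'k" where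
  "matrix_form G x y = (\<Sum>i\<in>keys y. lookup y i * (\<Sum>j\<in>keys x. lookup x j * G j i))"

lemma matrix_form_superset:
  assumes "finite S" "keys y \<subseteq> S"
  shows "matrix_form G x y = (\<Sum>i\<in>S. lookup y i * (\<Sum>j\<in>keys x. lookup x j * G j i))"
  unfolding matrix_form_def
  by (rule sum.mono_neutral_left) (use assms in \<open>auto simp: in_keys_iff\<close>)

lemma matrix_form_add_right: "matrix_form G x (y + z) = matrix_form G x y + matrix_form G x z"
  using Poly_Mapping.keys_add[of y z]
  by (simp add: matrix_form_superset[of "keys y \<union> keys z"] lookup_add distrib_right sum.distrib)

lemma matrix_form_scale_right: "matrix_form G x (pm_scale c y) = c * matrix_form G x y"
  by (simp add: matrix_form_superset[of "keys y"] keys_pm_scale sum_distrib_left mult.assoc)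

lemma matrix_form_commute:
  assumes "\<And>i j. G i j = G j i"
  shows "matrix_form G x y = matrix_form G y x"
proof -
  have "matrix_form G x y = (\<Sum>i\<in>keys y. \<Sum>j\<in>keys x. lookup x j * (lookup y i * G i j))"
    unfolding matrix_form_def by (simp add: sum_distrib_left assms mult.left_commute)
  also have "\<dots> = matrix_form G y x"
    unfolding matrix_form_def by (subst sum.swap) (simp add: sum_distrib_left)
  finally show ?thesis .
qed

lemma matrix_form_zero_right [simp]: "matrix_form G x 0 = 0"
  by (simp add: matrix_form_def)

text \<open>Over a finite field there are only finitely many restrictions to a finite
  \<open>D\<close>. Two distinct vectors of \<open>U\<close> therefore agree on \<open>D\<close>,
  and their difference is a nonzero vector of \<open>U\<close> supported off
  \<open>D\<close>.\<close>

lemma disjoint_vectors: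
  fixes U :: "('a \<Rightarrow>\<^sub>0 'k::{field,finite}) set"
  assumes U: "infinite U" "pm.subspace U"
  shows "\<exists>u :: nat \<Rightarrow> 'a \<Rightarrow>\<^sub>0 'k. (\<forall>n. u n \<in> U \<and> u n \<noteq> 0) \<and>
    (\<forall>m n. m \<noteq> n \<longrightarrow> keys (u m) \<inter> keys (u n) = {})"
proof -
  have avoid: "\<exists>A. finite A \<and> A \<inter> D = {} \<and> (\<exists>u\<in>U. u \<noteq> 0 \<and> A = keys u)"
    if D: "finite D" for D
  proof -
    define res where "res x = (\<lambda>i\<in>D. lookup x i)" for x :: "'a \<Rightarrow>\<^sub>0 'k"
    have "res ` U \<subseteq> D \<rightarrow>\<^sub>E UNIV"
      by (auto simp: res_def)
    moreover have "finite (D \<rightarrow>\<^sub>E (UNIV :: 'k set))"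
      using D by (intro finite_PiE) auto
    ultimately have "\<not> inj_on res U"
      using U(1) finite_subset finite_imageD by blast
    then obtain x y where xy: "x \<in> U" "y \<in> U" "x \<noteq> y" "res x = res y"
      unfolding inj_on_def by blast
    have "lookup x i = lookup y i" if "i \<in> D" for i
      using fun_cong[OF xy(4), of i] that by (simp add: res_def)
    then have "keys (x - y) \<inter> D = {}"
      by (auto simp: in_keys_iff lookup_minus)
    moreover have "\<exists>u\<in>U. u \<noteq> 0 \<and> keys (x - y) = keys u"
    proof
      show "x - y \<in> U"
        using U(2) xy(1,2) by (rule pm.subspace_diff)
      show "x - y \<noteq> 0 \<and> keys (x - y) = keys (x - y)"
        using xy(3) by simp
    qed
    ultimately show ?thesis
      using finite_keys by blast
  qed
  have "\<exists>A. (\<forall>n. finite (A n) \<and> (\<exists>u\<in>U. u \<noteq> 0 \<and> A n = keys u)) \<and>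
      (\<forall>m n :: nat. m \<noteq> n \<longrightarrow> A m \<inter> A n = {})"
    by (rule disjoint_sequence) (rule avoid)
  then obtain A :: "nat \<Rightarrow> 'a set" where A: "\<forall>n. finite (A n) \<and> (\<exists>u\<in>U. u \<noteq> 0 \<and> A n = keys u)"
    "\<forall>m n. m \<noteq> n \<longrightarrow> A m \<inter> A n = {}"
    by (elim exE conjE)
  have "\<forall>n. \<exists>u. u \<in> U \<and> u \<noteq> 0 \<and> A n = keys u"
    using A(1) by (simp add: Bex_def)
  from choice[OF this] obtain u where "\<forall>n. u n \<in> U \<and> u n \<noteq> 0 \<and> A n = keys (u n)" ..
  with A(2) show ?thesis
    by (intro exI[of _ u]) simp
qed

section \<open>Orthogonal complements\<close>

text \<open>Dimensions are replaced by cardinalities of sets: an infinite-dimensional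
  \<open>U\<close> is infinite, and a countable complement has countable dimension.\<close>

lemma (in aleph1_order) countable_orthogonal_matrix:
  assumes "cofinal_in {A :: (nat \<Rightarrow> bool) set. meagre A} (h ` W)"
  shows "\<exists>G :: 'a \<Rightarrow> 'a \<Rightarrow> 'k::{field,finite}. (\<forall>i j. G i j = G j i) \<and>
    (\<forall>U. infinite U \<and> pm.subspace U \<and> U \<subseteq> {x. keys x \<subseteq> W} \<longrightarrow>
      countable {x \<in> {x. keys x \<subseteq> W}. \<forall>y\<in>U. matrix_form G x y = 0})"
proof -
  obtain J :: "'a \<Rightarrow> nat \<Rightarrow> nat set" and z :: "'a \<Rightarrow> nat \<Rightarrow> bool"
    where fin_disj: "\<forall>w\<in>W. (\<forall>m. finite (J w m)) \<and> (\<forall>m n. m \<noteq> n \<longrightarrow> J w m \<inter> J w n = {})"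
    and capture: "\<forall>(S :: nat \<Rightarrow> nat set) t. (\<forall>n. finite (S n) \<and> S n \<noteq> {}) \<longrightarrow>
      (\<forall>m n. m \<noteq> n \<longrightarrow> S m \<inter> S n = {}) \<longrightarrow>
      (\<exists>w\<in>W. \<forall>\<^sub>\<infinity>m. \<exists>n. S n \<subseteq> J w m \<and> (\<forall>i\<in>S n. z w i = t i))"
    using cofinal_meagre_matching[OF assms] by (elim exE conjE)
  \<comment> \<open>Codes live on the natural numbers. For each possible bound
    \<open>\<alpha>\<close> of the supports, \<open>e \<alpha>\<close> transports the indices below
    \<open>\<alpha>\<close> injectively to them.\<close>
  define e where "e \<alpha> = to_nat_on (below \<alpha>)" for \<alpha>
  have e: "inj_on (e \<alpha>) (below \<alpha>)" for \<alpha>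
    unfolding e_def by (rule inj_on_to_nat_on[OF countable_below])
  obtain G :: "'a \<Rightarrow> 'a \<Rightarrow> 'k" where sym: "\<forall>i j. G i j = G j i"
    and G: "\<forall>\<gamma> \<alpha> \<xi> x. \<alpha> \<in> below \<gamma> \<and> \<xi> \<in> below \<gamma> \<and> \<gamma> \<in> keys x \<and> keys x \<subseteq> insert \<gamma> (below \<gamma>) \<longrightarrow>
      (\<exists>\<^sub>\<infinity>m. \<forall>i\<in>below \<alpha>. e \<alpha> i \<in> J \<xi> m \<longrightarrow>
        (\<Sum>j\<in>keys x. lookup x j * G j i) = of_bool (z \<xi> (e \<alpha> i)))"
    using generic_matrix[of e J z, OF e fin_disj] by (elim exE conjE)
  show ?thesis
  proof (intro exI[of _ G] conjI[OF sym] allI impI)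
    fix U :: "('a \<Rightarrow>\<^sub>0 'k) set"
    assume "infinite U \<and> pm.subspace U \<and> U \<subseteq> {x. keys x \<subseteq> W}"
    then have U: "infinite U" "pm.subspace U" "U \<subseteq> {x. keys x \<subseteq> W}"
      by simp_all
    obtain u :: "nat \<Rightarrow> 'a \<Rightarrow>\<^sub>0 'k" where "\<forall>n. u n \<in> U \<and> u n \<noteq> 0"
      and "\<forall>m n. m \<noteq> n \<longrightarrow> keys (u m) \<inter> keys (u n) = {}"
      using disjoint_vectors[OF U(1,2)] by (elim exE conjE)
    then have u: "\<And>n. u n \<in> U" "\<And>n. u n \<noteq> 0"
      and disj: "\<And>m n. m \<noteq> n \<Longrightarrow> keys (u m) \<inter> keys (u n) = {}"
      by blast+
    have "countable (\<Union>n. keys (u n))"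
      by (rule countable_UN) (simp_all add: countable_finite)
    moreover have "(\<Union>n. keys (u n)) \<subseteq> W"
      using u(1) U(3) by auto
    ultimately have "\<exists>\<alpha>\<in>W. (\<Union>n. keys (u n)) \<subseteq> below \<alpha>"
      by (rule countable_bounded)
    then obtain \<alpha> where \<alpha>: "\<alpha> \<in> W" "\<And>n. keys (u n) \<subseteq> below \<alpha>"
      by blast
    define S where "S n = e \<alpha> ` keys (u n)" for n
    have S_disj: "S m \<inter> S n = {}" if "m \<noteq> n" for m n
      unfolding S_def using inj_on_image_Int[OF e \<alpha>(2)[of m] \<alpha>(2)[of n]] disj[OF that] by simp
    have "\<exists>i. i \<in> keys (u n)" for n
      using u(2)[of n] by (simp add: ex_in_conv)
    then obtain p where p: "\<And>n. p n \<in> keys (u n)"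
      by metis
    \<comment> \<open>The target takes the value 1 at exactly one point of each support, so that it does not
      vanish at \<open>u n\<close>.\<close>
    define t where "t k \<longleftrightarrow> (\<exists>n. k = e \<alpha> (p n))" for k
    have t: "t (e \<alpha> i) \<longleftrightarrow> i = p n" if i: "i \<in> keys (u n)" for i n
    proof
      assume "t (e \<alpha> i)"
      then obtain m where m: "e \<alpha> i = e \<alpha> (p m)"
        unfolding t_def ..
      have "i = p m"
        using inj_onD[OF e m] i p[of m] \<alpha>(2) by blast
      then have "m = n"
        using disj[of m n] i p[of m] by blast
      then show "i = p n"
        using \<open>i = p m\<close> by simp
    qed (auto simp: t_def)
    have S: "finite (S n) \<and> S n \<noteq> {}" for n
      using p[of n] by (auto simp: S_def)
    have "\<exists>\<xi>\<in>W. \<forall>\<^sub>\<infinity>m. \<exists>n. S n \<subseteq> J \<xi> m \<and> (\<forall>i\<in>S n. z \<xi> i = t i)"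
      by (rule capture[THEN spec, THEN spec, THEN mp, THEN mp]) (intro allI impI S S_disj; assumption)+
    then obtain \<xi> where \<xi>: "\<xi> \<in> W" "\<forall>\<^sub>\<infinity>m. \<exists>n. S n \<subseteq> J \<xi> m \<and> (\<forall>i\<in>S n. z \<xi> i = t i)"
      by (elim bexE)
    have not_orth: "\<exists>y\<in>U. matrix_form G x y \<noteq> 0"
      if \<gamma>: "\<alpha> \<in> below \<gamma>" "\<xi> \<in> below \<gamma>" "\<gamma> \<in> keys x" "keys x \<subseteq> insert \<gamma> (below \<gamma>)" for x \<gamma>
    proof -
      have "\<exists>\<^sub>\<infinity>m. \<forall>i\<in>below \<alpha>. e \<alpha> i \<in> J \<xi> m \<longrightarrow>
          (\<Sum>j\<in>keys x. lookup x j * G j i) = of_bool (z \<xi> (e \<alpha> i))"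
        by (rule G[THEN spec[of _ \<gamma>], THEN spec, THEN spec, THEN spec, THEN mp])
          (intro conjI \<gamma>)
      \<comment> \<open>Genericity holds for infinitely many \<open>m\<close> and capture for almost
        all, so some \<open>m\<close> has both. On the support of the corresponding
        \<open>u n\<close> the form then follows \<open>z\<close>, which agrees there with
        \<open>t\<close>, the indicator of \<open>p n\<close>.\<close>
      from INFM_EX[OF INFM_conjI[OF this \<xi>(2)]]
      obtain m n where *: "\<forall>i\<in>below \<alpha>. e \<alpha> i \<in> J \<xi> m \<longrightarrow>
          (\<Sum>j\<in>keys x. lookup x j * G j i) = of_bool (z \<xi> (e \<alpha> i))"
        and n: "S n \<subseteq> J \<xi> m" "\<forall>i\<in>S n. z \<xi> i = t i"
        by (elim exE conjE)
      have "matrix_form G x (u n) = (\<Sum>i\<in>keys (u n). lookup (u n) i * of_bool (i = p n))"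
        unfolding matrix_form_def
      proof (rule sum.cong[OF refl])
        fix i assume i: "i \<in> keys (u n)"
        then have "e \<alpha> i \<in> S n" "i \<in> below \<alpha>"
          using \<alpha>(2) by (auto simp: S_def)
        then have "(\<Sum>j\<in>keys x. lookup x j * G j i) = of_bool (i = p n)"
          using * n t[OF i] by auto
        then show "lookup (u n) i * (\<Sum>j\<in>keys x. lookup x j * G j i) =
            lookup (u n) i * of_bool (i = p n)"
          by simp
      qed
      also have "\<dots> = (\<Sum>i\<in>keys (u n). if i = p n then lookup (u n) i else 0)"
        by (rule sum.cong) auto
      also have "\<dots> = lookup (u n) (p n)"
        using p[of n] by simp
      finally have "matrix_form G x (u n) \<noteq> 0"
        using p[of n] by (simp add: in_keys_iff)
      then show ?thesis
        using u(1) by blast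
    qed
    \<comment> \<open>A top index that is not below \<open>\<delta>\<close> lies above both
      \<open>\<alpha>\<close> and \<open>\<xi>\<close>, so orthogonal vectors are supported below
      \<open>\<delta>\<close>.\<close>
    obtain \<delta> where \<delta>: "\<alpha> \<in> below \<delta>" "\<xi> \<in> below \<delta>" "\<delta> \<in> W"
      using countable_bounded[of "{\<alpha>, \<xi>}"] \<alpha>(1) \<xi>(1) by auto
    have "keys x \<subseteq> below \<delta>"
      if x: "keys x \<subseteq> W" "\<forall>y\<in>U. matrix_form G x y = 0" for x
    proof (cases "x = 0")
      case False
      then obtain \<gamma> where \<gamma>: "\<gamma> \<in> keys x" "keys x \<subseteq> insert \<gamma> (below \<gamma>)"
        using finite_has_top[of "keys x"] x(1) by auto
      have "\<gamma> \<in> below \<delta>"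
      proof (rule ccontr)
        assume "\<gamma> \<notin> below \<delta>"
        then have "\<gamma> = \<delta> \<or> \<delta> \<in> below \<gamma>"
          using below_total[of \<gamma> \<delta>] \<gamma>(1) x(1) \<delta>(3) by blast
        then have "\<alpha> \<in> below \<gamma>" "\<xi> \<in> below \<gamma>"
          using \<delta>(1,2) below_trans by blast+
        then show False
          using not_orth[OF _ _ \<gamma>] x(2) by blast
      qed
      then show ?thesis
        using \<gamma>(2) below_trans by blast
    qed simp
    then have "{x \<in> {x. keys x \<subseteq> W}. \<forall>y\<in>U. matrix_form G x y = 0} \<subseteq> {x. keys x \<subseteq> below \<delta>}"
      by blast
    then show "countable {x \<in> {x. keys x \<subseteq> W}. \<forall>y\<in>U. matrix_form G x y = 0}"
      by (rule countable_subset[OF _ countable_keys_subset[OF countable_below]])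
  qed
qed

section \<open>The Gross space of dimension \<open>\<omega>\<^sub>1\<close>\<close>

theorem theorem4:
  assumes "cof {A :: (nat \<Rightarrow> bool) set. meagre A} =o cardSuc natLeq"
  shows "\<exists>(scale :: 'k::{field,finite} \<Rightarrow> (nat set \<Rightarrow>\<^sub>0 'k) \<Rightarrow> (nat set \<Rightarrow>\<^sub>0 'k)) E \<Phi>.
           gross_space scale E \<Phi> \<and> cdim scale E =o cardSuc natLeq"
proof -
  obtain F where F: "cofinal_in {A :: (nat \<Rightarrow> bool) set. meagre A} F"
    and "cof {A :: (nat \<Rightarrow> bool) set. meagre A} = |F|"
    using cof_attained by blast
  then have card_F: "|F| =o cardSuc natLeq"
    using assms by simp
  \<comment> \<open>The ambient vectors are indexed by \<open>nat set\<close>, so the index set has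
    to be found there: \<open>\<omega>\<^sub>1\<close> is at most the continuum, and
    \<open>F\<close> has a copy \<open>W\<close> of its size among the sets of naturals.\<close>
  have "natLeq <o |UNIV :: nat set set|"
    using ordIso_ordLess_trans[OF ordIso_symmetric[OF card_of_nat] card_of_Pow] by simp
  then have "cardSuc natLeq \<le>o |UNIV :: nat set set|"
    by (rule cardSuc_least[OF natLeq_Card_order card_of_Card_order])
  then have "|F| \<le>o |UNIV :: nat set set|"
    using card_F ordIso_ordLeq_trans by blast
  from iffD1[OF internalize_card_of_ordLeq2 this]
  obtain W :: "nat set set" where FW: "|F| =o |W|"
    by (elim exE conjE)
  have W: "|W| =o cardSuc natLeq"
    using ordIso_symmetric[OF FW] card_F by (rule ordIso_transitive)
  from iffD2[OF card_of_ordIso ordIso_symmetric[OF FW]] obtain h where "bij_betw h W F" ..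
  then have h: "F = h ` W"
    by (simp add: bij_betw_def)
  obtain lt where "aleph1_order W lt"
    using aleph1_order_exists[OF W] .
  then interpret aleph1_order W lt .
  obtain G :: "nat set \<Rightarrow> nat set \<Rightarrow> 'k" where sym: "\<forall>i j. G i j = G j i"
    and G: "\<forall>U. infinite U \<and> pm.subspace U \<and> U \<subseteq> {x. keys x \<subseteq> W} \<longrightarrow>
      countable {x \<in> {x. keys x \<subseteq> W}. \<forall>y\<in>U. matrix_form G x y = 0}"
    using countable_orthogonal_matrix[OF F[unfolded h]] by (elim exE conjE)
  define E where "E = {x :: nat set \<Rightarrow>\<^sub>0 'k. keys x \<subseteq> W}"
  have comm: "matrix_form G x y = matrix_form G y x" for x y
    by (rule matrix_form_commute) (simp add: sym)
  have add_left: "matrix_form G (x + y) v = matrix_form G x v + matrix_form G y v" for x y v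
    by (metis comm matrix_form_add_right)
  have scale_left: "matrix_form G (pm_scale c x) v = c * matrix_form G x v" for c x v
    by (metis comm matrix_form_scale_right)
  have zero_left: "matrix_form G 0 v = 0" for v
    by (metis comm matrix_form_zero_right)
  have dim_E: "cdim pm_scale E =o cardSuc natLeq"
    unfolding E_def using cdim_keys W by (rule ordIso_transitive)
  have "natLeq <o cdim pm_scale E"
    using cardSuc_greater[OF natLeq_Card_order] ordIso_symmetric[OF dim_E]
    by (rule ordLess_ordIso_trans)
  \<comment> \<open>A basis of \<open>V\<close> is a subset of \<open>V\<close>, so a countable
    subspace has dimension at most \<open>natLeq\<close>, which is less than the dimension of
    \<open>E\<close>.\<close>
  then have countable_dim: "cdim pm_scale V <o cdim pm_scale E"
    if V: "pm.subspace V" "countable V" for V :: "(nat set \<Rightarrow>\<^sub>0 'k) set"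
  proof -
    obtain B where B: "basis_of pm_scale V B"
      using pm.basis_of_exists[OF V(1)] by blast
    then have "B \<subseteq> V"
      by (simp add: basis_of_def)
    then have "|B| \<le>o natLeq"
      using countable_subset[OF _ V(2)] by (simp add: countable_card_le_natLeq)
    with pm.cdim_eq_card_basis[OF B] have "cdim pm_scale V \<le>o natLeq"
      by (rule ordIso_ordLeq_trans)
    then show ?thesis
      using \<open>natLeq <o cdim pm_scale E\<close> by (rule ordLeq_ordLess_trans)
  qed
  have "gross_space pm_scale E (matrix_form G)"
  proof
    show "pm.subspace E"
      unfolding E_def by (rule subspace_keys)
    show "cinfinite (cdim pm_scale E)"
      using ordLess_imp_ordLeq[OF \<open>natLeq <o cdim pm_scale E\<close>] natLeq_cinfinite
      by (rule cinfinite_mono)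
    show "cdim pm_scale {x \<in> E. \<forall>y\<in>U. matrix_form G x y = 0} <o cdim pm_scale E"
      if U: "pm.subspace U" "U \<subseteq> E" "cinfinite (cdim pm_scale U)" for U
    proof (rule countable_dim)
      obtain B where B: "basis_of pm_scale U B"
        using pm.basis_of_exists[OF U(1)] by blast
      have "cinfinite |B|"
        using ordIso_imp_ordLeq[OF pm.cdim_eq_card_basis[OF B]] U(3) by (rule cinfinite_mono)
      moreover have "B \<subseteq> U"
        using B by (simp add: basis_of_def)
      ultimately have "infinite U"
        unfolding cinfinite_def Field_card_of using finite_subset by blast
      then show "countable {x \<in> E. \<forall>y\<in>U. matrix_form G x y = 0}"
        using G[rule_format, of U] U(1,2) by (simp add: E_def)
      show "pm.subspace {x \<in> E. \<forall>y\<in>U. matrix_form G x y = 0}"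
      proof (rule pm.subspaceI)
        show "0 \<in> {x \<in> E. \<forall>y\<in>U. matrix_form G x y = 0}"
          using pm.subspace_0[OF \<open>pm.subspace E\<close>] by (simp add: zero_left)
        show "x + y \<in> {x \<in> E. \<forall>y\<in>U. matrix_form G x y = 0}"
          if "x \<in> {x \<in> E. \<forall>y\<in>U. matrix_form G x y = 0}"
            "y \<in> {x \<in> E. \<forall>y\<in>U. matrix_form G x y = 0}" for x y
          using pm.subspace_add[OF \<open>pm.subspace E\<close>] that by (simp add: add_left)
        show "pm_scale c x \<in> {x \<in> E. \<forall>y\<in>U. matrix_form G x y = 0}"
          if "x \<in> {x \<in> E. \<forall>y\<in>U. matrix_form G x y = 0}" for c x
          using pm.subspace_scale[OF \<open>pm.subspace E\<close>] that by (simp add: scale_left)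
      qed
    qed
  qed (rule comm add_left scale_left matrix_form_add_right matrix_form_scale_right)+
  with dim_E show ?thesis
    by (intro exI[of _ pm_scale] exI[of _ E] exI[of _ "matrix_form G"] conjI)
qed

end
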